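(* Let $M=\begin{pmatrix}A&B\\ C&A^T\end{pmatrix}\in \mathrm{Sp}(2n)$ be a Wonenburger matrix with no eigenvalues on the negative real axis $\mathbb{R}^-=(-\infty,0)$. (For a Wonenburger matrix, the condition $\sigma(M)\cap\mathbb{R}^-=\emptyset$ is equivalent to $\sigma(A)\cap(-\infty,-1]=\emptyset$.) Then $M$ has at least one real symplectic square root.
   Context: $\mathrm{Sp}(2n)$ is the group of real $2n\times 2n$ matrices $M$ with $M^TJM=J$, where $J=\begin{pmatrix}0&-I_n\\ I_n&0\end{pmatrix}$. A Wonenburger matrix is a matrix $M=\begin{pmatrix}A&B\\ C&A^T\end{pmatrix}$ with $A,B,C$ real $n\times n$ matrices satisfying $B=B^T$, $C=C^T$, $AB=BA^T$, $A^TC=CA$, $A^2-BC=I$ (these relations ensure $M\in\mathrm{Sp}(2n)$). A real symplectic square root of $M\in\mathrm{Sp}(2n)$ is a matrix $X\in\mathrm{Sp}(2n)$ with $X^2=M$. $\sigma(\cdot)$ denotes the set of complex eigenvalues. *)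

theory Defs
  imports "Jordan_Normal_Form.Spectral_Radius"
begin

definition J_mat :: "nat \<Rightarrow> real mat" where
  "J_mat n = four_block_mat (0\<^sub>m n n) (- 1\<^sub>m n) (1\<^sub>m n) (0\<^sub>m n n)"

(* "Sp n" is the group Sp(2n): the argument is half the matrix size. *)
definition Sp :: "nat \<Rightarrow> real mat set" where
  "Sp n = {M \<in> carrier_mat (2 * n) (2 * n). M\<^sup>T * J_mat n * M = J_mat n}"

definition wonenburger :: "nat \<Rightarrow> real mat \<Rightarrow> real mat \<Rightarrow> real mat \<Rightarrow> real mat \<Rightarrow> bool" where
  "wonenburger n M A B C \<longleftrightarrow>
     A \<in> carrier_mat n n \<and> B \<in> carrier_mat n n \<and> C \<in> carrier_mat n n \<and>
     M = four_block_mat A B C A\<^sup>T \<and>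
     B = B\<^sup>T \<and> C = C\<^sup>T \<and> A * B = B * A\<^sup>T \<and> A\<^sup>T * C = C * A \<and>
     A * A - B * C = 1\<^sub>m n"

definition symplectic_sqrt :: "nat \<Rightarrow> real mat \<Rightarrow> real mat \<Rightarrow> bool" where
  "symplectic_sqrt n M X \<longleftrightarrow> X \<in> Sp n \<and> X ^\<^sub>m 2 = M"

(* The set of complex eigenvalues of a real matrix. *)
definition cspectrum :: "real mat \<Rightarrow> complex set" where
  "cspectrum M = spectrum (map_mat complex_of_real M)"

lemma wonenburger_in_Sp:
  assumes "wonenburger n M A B C"
  shows "M \<in> Sp n"
proof -
  have c: "A \<in> carrier_mat n n" "B \<in> carrier_mat n n" "C \<in> carrier_mat n n"
    and M: "M = four_block_mat A B C A\<^sup>T"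
    and BT: "B\<^sup>T = B" and CT: "C\<^sup>T = C"
    and AB: "A * B = B * A\<^sup>T" and AC: "A\<^sup>T * C = C * A"
    and E: "A * A - B * C = 1\<^sub>m n"
    using assms unfolding wonenburger_def by auto
  have cT: "A\<^sup>T \<in> carrier_mat n n" using c by simp
  have "(A * A - B * C)\<^sup>T = 1\<^sub>m n" using E by simp
  then have ET: "A\<^sup>T * A\<^sup>T - C * B = 1\<^sub>m n"
    using c by (simp add: transpose_minus[of _ n n] transpose_mult[of _ n n _ n] BT CT)
  have MT: "M\<^sup>T = four_block_mat A\<^sup>T C B A"
    unfolding M using transpose_four_block_mat[OF c cT] by (simp add: BT CT)
  have o: "0\<^sub>m n n \<in> carrier_mat n n" "- 1\<^sub>m n \<in> carrier_mat n n" "1\<^sub>m n \<in> carrier_mat n n"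
    for n :: nat by auto
  have neg: "X * - 1\<^sub>m n = - X" if "X \<in> carrier_mat n n" for X :: "real mat"
    using that by (simp add: uminus_mult_right_mat)
  have "M\<^sup>T * J_mat n = four_block_mat C (- A\<^sup>T) A (- B)"
    unfolding MT J_mat_def
    by (subst mult_four_block_mat[OF cT c(3) c(2) c(1) o(1) o(2) o(3) o(1)])
       (use c in \<open>simp add: neg\<close>)
  then have "M\<^sup>T * J_mat n * M =
      four_block_mat (C * A + - A\<^sup>T * C) (C * B + - A\<^sup>T * A\<^sup>T) (A * A + - B * C) (A * B + - B * A\<^sup>T)"
    unfolding M using c by (simp add: mult_four_block_mat[of _ n n _ n _ n])
  also have "C * A + - A\<^sup>T * C = 0\<^sub>m n n"
    using c AC[symmetric] by (simp add: uminus_mult_left_mat) (auto intro!: eq_matI)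
  also have "A * B + - B * A\<^sup>T = 0\<^sub>m n n"
    using c AB by (simp add: uminus_mult_left_mat) (auto intro!: eq_matI)
  also have "A * A + - B * C = 1\<^sub>m n"
    using c E by (simp add: uminus_mult_left_mat add_uminus_minus_mat[of _ n n])
  also have "C * B + - A\<^sup>T * A\<^sup>T = - 1\<^sub>m n"
    unfolding ET[symmetric] using c by (simp add: uminus_mult_left_mat) (auto intro!: eq_matI)
  finally have "M\<^sup>T * J_mat n * M = J_mat n" unfolding J_mat_def .
  moreover have "M \<in> carrier_mat (2 * n) (2 * n)"
    unfolding M mult_2 using c by simp
  ultimately show ?thesis unfolding Sp_def by simp
qed

end

theory Submission
  imports
    Defs
    "HOL-Computational_Algebra.Field_as_Ring"
begin

text \<open>
  A Wonenburger matrix behaves like a two-by-two matrix of determinant one over the polynomials in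
  \<open>A\<close>. Write \<open>x\<close> for the block diagonal matrix of \<open>A\<close> and \<open>A\<^sup>T\<close>, and \<open>t\<close> for the block antidiagonal matrix
  of \<open>B\<close> and \<open>C\<close>. The defining relations say that \<open>x\<close> and \<open>t\<close> commute and \<open>t\<^sup>2 = x\<^sup>2 - 1\<close>, so that the
  matrices \<open>p(x) + q(x) * t\<close> multiply as in a quadratic extension of a polynomial ring
  (\<open>wmat_mult\<close>). In this ring \<open>M = x + t\<close> has the inverse \<open>x - t\<close>, and every element of norm
  \<open>p\<^sup>2 - (x\<^sup>2 - 1) * q\<^sup>2 = 1\<close> is a Wonenburger matrix and therefore symplectic (\<open>wonenburger_wmat\<close>).

  As in \<open>SL\<^sub>2\<close>, with \<open>2 * x\<close> in place of the trace, one has \<open>(M + 1)\<^sup>2 = (2 + 2 * x) * M\<close>. If \<open>r\<close> is a polynomial in \<open>x\<close> with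
  \<open>r\<^sup>2 * (2 + 2 * x) = 1\<close>, then \<open>X = (M + 1) * r\<close> satisfies \<open>X\<^sup>2 = M\<close>, and its norm is again one. By the
  Cayley-Hamilton theorem the equation for \<open>r\<close> need only hold modulo the characteristic polynomial
  of \<open>A\<close>. There it is solvable over the reals because no root \<open>z\<close> of that polynomial makes
  \<open>2 + 2 * z\<close> a nonpositive real number: modulo a prime factor one interpolates the principal square
  root at one of its roots, and the prime factors are put together by the Chinese remainder theorem
  and Hensel lifting (\<open>inverse_sqrt_mod\<close>).

  The comparison of the two spectral conditions comes from the factorization
  \<open>(M - k) * (M - 1 / k) = 2 * (x - (k + 1 / k) / 2) * M\<close>. Taking determinants, \<open>k\<close> or \<open>1 / k\<close> is an
  eigenvalue of \<open>M\<close> if and only if \<open>(k + 1 / k) / 2\<close> is one of \<open>A\<close>, and for negative \<open>k\<close> this number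
  ranges over the half-line of all numbers up to \<open>-1\<close>.
\<close>

section \<open>Inverse square roots modulo a real polynomial\<close>

abbreviation ceval :: "real poly \<Rightarrow> complex \<Rightarrow> complex" where
  "ceval p z \<equiv> poly (map_poly complex_of_real p) z"

lemma ceval_arith [simp]:
  "ceval (p + q) z = ceval p z + ceval q z" "ceval (p - q) z = ceval p z - ceval q z"
  "ceval (p * q) z = ceval p z * ceval q z" "ceval (p ^ k) z = ceval p z ^ k"
proof -
  interpret h: map_poly_comm_ring_hom complex_of_real ..
  show "ceval (p + q) z = ceval p z + ceval q z" "ceval (p - q) z = ceval p z - ceval q z"
    "ceval (p * q) z = ceval p z * ceval q z" "ceval (p ^ k) z = ceval p z ^ k"
    by (simp_all add: hom_distribs)
qed

lemma coprime_bezout: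
  fixes p q :: "'a :: euclidean_ring_gcd"
  assumes "coprime p q"
  obtains a b where "a * p + b * q = 1"
  using bezout_coefficients_fst_snd[of p q] assms by auto

text \<open>A real prime polynomial plays the role of the minimal polynomial over the reals of any of its
  complex roots.\<close>

lemma prime_dvd_of_common_root:
  fixes g p :: "real poly"
  assumes "prime g" "ceval g z = 0" "ceval p z = 0"
  shows "g dvd p"
proof (rule ccontr)
  assume "\<not> g dvd p"
  then have "coprime g p" using assms(1) by (simp add: prime_imp_coprime)
  then obtain a b where "a * g + b * p = 1" by (rule coprime_bezout)
  then have "ceval (a * g + b * p) z = 1" by simp
  then show False using assms by simp
qed

lemma prime_poly_has_root:
  fixes g :: "real poly"
  assumes "prime g"
  obtains z where "ceval g z = 0"
proof -
  have "g \<noteq> 0" "\<not> is_unit g" using assms not_prime_unit by (simp, blast)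
  then have "degree g \<noteq> 0" using is_unit_iff_degree by blast
  then have "degree (map_poly complex_of_real g) \<noteq> 0" by simp
  then have "\<not> constant (poly (map_poly complex_of_real g))"
    by (simp add: constant_degree)
  then show ?thesis using fundamental_theorem_of_algebra that by blast
qed

text \<open>For nonreal \<open>z\<close> the numbers \<open>1, z\<close> form a real basis of the complex plane, so a linear
  polynomial suffices; a real \<open>z\<close> only allows real values.\<close>

lemma real_poly_interpolates:
  assumes "z \<in> \<real> \<Longrightarrow> w \<in> \<real>"
  obtains q where "ceval q z = w"
proof (cases "z \<in> \<real>")
  case True
  then obtain r where "w = of_real r" using assms by (blast elim: Reals_cases)
  then have "ceval [:r:] z = w" by (subst of_real_hom.map_poly_pCons_hom) simp
  then show ?thesis by (rule that)
next
  case False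
  then have Im: "Im z \<noteq> 0" by (simp add: complex_is_Real_iff)
  \<comment> \<open>The slope is fixed by the imaginary part, the constant term then by the real part.\<close>
  have "ceval [:Re w - Im w / Im z * Re z, Im w / Im z:] z = w"
    using Im by (simp add: complex_eq_iff hom_distribs)
  then show ?thesis by (rule that)
qed

text \<open>At a real point the value of \<open>l\<close> is real, and excluding the nonpositive axis makes its
  principal square root real; this is where the spectral condition of the theorem enters.\<close>

lemma inverse_sqrt_at_point:
  assumes l: "ceval l z \<notin> complex_of_real ` {..0}"
  obtains q where "ceval q z ^ 2 * ceval l z = 1"
proof -
  define w where "w = inverse (csqrt (ceval l z))"
  have nz: "ceval l z \<noteq> 0" using l by force
  have w: "w ^ 2 * ceval l z = 1"
    unfolding w_def using nz by (simp add: power_inverse)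
  have "w \<in> \<real>" if "z \<in> \<real>"
  proof -
    obtain r where r: "z = of_real r" using \<open>z \<in> \<real>\<close> by (blast elim: Reals_cases)
    have e: "ceval l z = of_real (poly l r)" unfolding r by simp
    with l have "poly l r > 0" by force
    then have "csqrt (ceval l z) = of_real (sqrt (poly l r))" unfolding e by simp
    then show ?thesis unfolding w_def by simp
  qed
  then obtain q where "ceval q z = w" by (rule real_poly_interpolates)
  with w show ?thesis by (intro that[of q]) simp
qed

text \<open>Interpolating \<open>p\<close> modulo \<open>f\<close> and \<open>q\<close> modulo \<open>g\<close> by the Chinese remainder theorem preserves
  the congruence, because \<open>r\<^sup>2 * l - p\<^sup>2 * l\<close> is divisible by \<open>r - p\<close>, and likewise for \<open>q\<close>.\<close>

lemma inverse_sqrt_mod_coprime: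
  fixes f g :: "'a :: euclidean_ring_gcd"
  assumes "coprime f g" "f dvd p\<^sup>2 * l - 1" "g dvd q\<^sup>2 * l - 1"
  obtains r where "f * g dvd r\<^sup>2 * l - 1"
proof -
  obtain a b where ab: "a * f + b * g = 1" using assms(1) by (rule coprime_bezout)
  define r where "r = p + (q - p) * (a * f)"
  have r': "r = q + (p - q) * (b * g)"
  proof -
    have "r = p + (q - p) * (1 - b * g)" unfolding r_def ab[symmetric] by simp
    then show ?thesis by (simp add: algebra_simps)
  qed
  have "r\<^sup>2 * l - 1 = (p\<^sup>2 * l - 1) + f * (a * (q - p) * (r + p) * l)"
    unfolding r_def by (simp add: algebra_simps power2_eq_square)
  then have f: "f dvd r\<^sup>2 * l - 1" using assms(2) by (metis dvd_add dvd_triv_left)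
  have "r\<^sup>2 * l - 1 = (q\<^sup>2 * l - 1) + g * (b * (p - q) * (r + q) * l)"
    unfolding r' by (simp add: algebra_simps power2_eq_square)
  then have "g dvd r\<^sup>2 * l - 1" using assms(3) by (metis dvd_add dvd_triv_left)
  with f show ?thesis using assms(1) by (intro that[of r]) (rule divides_mult)
qed

text \<open>Hensel lifting. One Newton step for \<open>q\<^sup>2 * l = 1\<close> replaces an error \<open>f * h\<close> by a multiple of its
  square. Hence the precision even doubles to \<open>f\<^sup>2\<close>; a single additional factor \<open>g\<close> is all that the
  induction over prime factors asks for.\<close>

lemma inverse_sqrt_mod_lift:
  fixes e f g :: "'a :: comm_ring_1"
  assumes e: "2 * e = 1" and "g dvd f" "f dvd q\<^sup>2 * l - 1"
  obtains r where "f * g dvd r\<^sup>2 * l - 1"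
proof -
  obtain h where h: "q\<^sup>2 * l - 1 = f * h" using assms(3) by (auto elim: dvdE)
  obtain k where k: "f = g * k" using assms(2) by (auto elim: dvdE)
  define r where "r = q - e * f * h * q"
  have "r\<^sup>2 * l - 1 =
      (q\<^sup>2 * l - 1) - (2 * e) * (q\<^sup>2 * l) * (f * h) + e\<^sup>2 * (q\<^sup>2 * l) * (f * h)\<^sup>2"
    unfolding r_def by (simp add: algebra_simps power2_eq_square)
  also have "\<dots> = (f * h)\<^sup>2 * (e\<^sup>2 * (1 + f * h) - 1)"
  proof -
    have "q\<^sup>2 * l = 1 + f * h" using h by (simp add: algebra_simps)
    then show ?thesis unfolding e by (simp add: algebra_simps power2_eq_square)
  qed
  also have "(f * h)\<^sup>2 = f * g * (k * h\<^sup>2)"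
    by (simp add: k algebra_simps power2_eq_square)
  finally have "r\<^sup>2 * l - 1 = f * g * (k * h\<^sup>2 * (e\<^sup>2 * (1 + f * h) - 1))"
    by (simp add: mult.assoc)
  then show ?thesis by (intro that[of r]) simp
qed

text \<open>The polynomial core: \<open>l\<close> has a real inverse square root modulo \<open>f\<close> as soon as its values at
  the complex roots of \<open>f\<close> have a principal square root compatible with conjugation. The prime
  factors of \<open>f\<close> are added one at a time. A new factor is treated by evaluation at one of its roots and
  the Chinese remainder theorem, a repeated one by Hensel lifting.\<close>

lemma inverse_sqrt_mod:
  fixes f l :: "real poly"
  assumes "f \<noteq> 0"
    and "\<And>z. ceval f z = 0 \<Longrightarrow> ceval l z \<notin> complex_of_real ` {..0}"
  shows "\<exists>q. f dvd q\<^sup>2 * l - 1"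
  using assms
proof (induction f rule: prime_divisors_induct)
  case zero
  then show ?case by simp
next
  case (unit f)
  then show ?case by (blast intro: unit_imp_dvd)
next
  case (factor g f)
  have "\<exists>q. f dvd q\<^sup>2 * l - 1"
    using factor.prems by (intro factor.IH) auto
  then obtain p where p: "f dvd p\<^sup>2 * l - 1" ..
  show ?case
  proof (cases "g dvd f")
    case True
    have "2 * [:1/2:] = (1 :: real poly)" by (simp add: numeral_poly one_pCons)
    then obtain r where "f * g dvd r\<^sup>2 * l - 1"
      using True p by (rule inverse_sqrt_mod_lift)
    then show ?thesis by (auto simp: mult.commute)
  next
    case False
    obtain z where z: "ceval g z = 0" using factor.hyps by (rule prime_poly_has_root)
    then have "ceval (g * f) z = 0" by simp
    then have "ceval l z \<notin> complex_of_real ` {..0}" by (rule factor.prems)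
    then obtain q where "ceval q z ^ 2 * ceval l z = 1" by (rule inverse_sqrt_at_point)
    then have "ceval (q\<^sup>2 * l - 1) z = 0" by simp
    with factor.hyps z have q: "g dvd q\<^sup>2 * l - 1" by (rule prime_dvd_of_common_root)
    have "coprime g f" using factor.hyps False by (rule prime_imp_coprime)
    then show ?thesis using q p by (rule inverse_sqrt_mod_coprime) blast
  qed
qed

section \<open>Polynomials in a matrix and the Cayley-Hamilton theorem\<close>

text \<open>Evaluation of a polynomial at a square matrix by Horner's scheme; the unit of a matrix ring
  depends on the dimension, which is read off from \<open>A\<close>.\<close>

definition poly_mat :: "'a :: comm_ring_1 mat \<Rightarrow> 'a poly \<Rightarrow> 'a mat" where
  "poly_mat A p =
     fold_coeffs (\<lambda>a X. a \<cdot>\<^sub>m 1\<^sub>m (dim_row A) + A * X) p (0\<^sub>m (dim_row A) (dim_row A))"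

lemma poly_mat_0 [simp]: "A \<in> carrier_mat n n \<Longrightarrow> poly_mat A 0 = 0\<^sub>m n n"
  by (simp add: poly_mat_def)

lemma poly_mat_pCons:
  assumes A: "A \<in> carrier_mat n n"
  shows "poly_mat A (pCons a p) = a \<cdot>\<^sub>m 1\<^sub>m n + A * poly_mat A p"
proof (cases "a = 0 \<and> p = 0")
  case True
  have "0 \<cdot>\<^sub>m 1\<^sub>m n + A * 0\<^sub>m n n = 0\<^sub>m n n" using A by auto
  with True A show ?thesis by simp
next
  case False
  with A show ?thesis by (auto simp: poly_mat_def)
qed

lemma poly_mat_carrier [simp]:
  assumes A: "A \<in> carrier_mat n n"
  shows "poly_mat A p \<in> carrier_mat n n"
  by (induction p) (use A in \<open>auto simp: poly_mat_pCons[OF A]\<close>)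

lemma poly_mat_dim [simp]:
  assumes A: "A \<in> carrier_mat n n"
  shows "dim_row (poly_mat A p) = n" "dim_col (poly_mat A p) = n"
  using poly_mat_carrier[OF A, of p] by auto

lemma poly_mat_const: "A \<in> carrier_mat n n \<Longrightarrow> poly_mat A [:a:] = a \<cdot>\<^sub>m 1\<^sub>m n"
  by (auto simp: poly_mat_pCons)

lemma poly_mat_linear:
  "A \<in> carrier_mat n n \<Longrightarrow> poly_mat A [:a, b:] = a \<cdot>\<^sub>m 1\<^sub>m n + b \<cdot>\<^sub>m A"
  by (simp add: poly_mat_pCons[of A n] mult_smult_distrib[of A n n "1\<^sub>m n" n])

lemma poly_mat_add:
  assumes A: "A \<in> carrier_mat n n"
  shows "poly_mat A (p + q) = poly_mat A p + poly_mat A q"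
proof (induction p q rule: poly_induct2)
  case 0
  show ?case using A by simp
next
  case (pCons a p b q)
  show ?case
    using A poly_mat_carrier[OF A, of p] poly_mat_carrier[OF A, of q]
    by (simp add: poly_mat_pCons[OF A] pCons mult_add_distrib_mat[of A n n _ n] add_smult_distrib_right_mat)
       (auto intro!: eq_matI)
qed

lemma poly_mat_smult:
  assumes A: "A \<in> carrier_mat n n"
  shows "poly_mat A (Polynomial.smult c p) = c \<cdot>\<^sub>m poly_mat A p"
proof (induction p)
  case 0
  show ?case using A by simp
next
  case (pCons a p)
  have "poly_mat A (Polynomial.smult c (pCons a p)) = (c * a) \<cdot>\<^sub>m 1\<^sub>m n + c \<cdot>\<^sub>m (A * poly_mat A p)"
    by (simp add: poly_mat_pCons[OF A] pCons mult_smult_distrib[OF A poly_mat_carrier[OF A]])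
  also have "\<dots> = c \<cdot>\<^sub>m poly_mat A (pCons a p)"
    using A poly_mat_carrier[OF A, of p]
    by (auto intro!: eq_matI simp: poly_mat_pCons[OF A] algebra_simps)
  finally show ?case .
qed

lemma poly_mat_mult:
  assumes A: "A \<in> carrier_mat n n"
  shows "poly_mat A (p * q) = poly_mat A p * poly_mat A q"
proof (induction p)
  case 0
  show ?case using A poly_mat_carrier[OF A, of q] by simp
next
  case (pCons a p)
  note c = A poly_mat_carrier[OF A]
  have "0 \<cdot>\<^sub>m 1\<^sub>m n = (0\<^sub>m n n :: 'a mat)" by auto
  then have "poly_mat A (pCons a p * q) = a \<cdot>\<^sub>m poly_mat A q + A * (poly_mat A p * poly_mat A q)"
    using mult_carrier_mat[OF A mult_carrier_mat[OF c(2) c(2)], of p q]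
    by (simp add: poly_mat_add[OF A] poly_mat_smult[OF A] poly_mat_pCons[OF A] pCons)
  also have "A * (poly_mat A p * poly_mat A q) = A * poly_mat A p * poly_mat A q"
    by (rule assoc_mult_mat[symmetric]) (rule c)+
  also have "a \<cdot>\<^sub>m poly_mat A q + A * poly_mat A p * poly_mat A q
      = (a \<cdot>\<^sub>m 1\<^sub>m n + A * poly_mat A p) * poly_mat A q"
    using poly_mat_carrier[OF A, of p] poly_mat_carrier[OF A, of q] A
    by (simp add: add_mult_distrib_mat[of _ n n _ _ n] mult_smult_assoc_mat[of _ n n _ n])
  finally show ?case by (simp add: poly_mat_pCons[OF A])
qed

text \<open>For \<open>A' = A\<close> this is commutation with everything that commutes with \<open>A\<close>; for \<open>A' = A\<^sup>T\<close> it carries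
  the relation \<open>A * B = B * A\<^sup>T\<close> of Wonenburger matrices over to polynomials in \<open>A\<close>.\<close>

lemma poly_mat_intertwine:
  assumes A: "A \<in> carrier_mat n n" and A': "A' \<in> carrier_mat n n" and B: "B \<in> carrier_mat n n"
    and AB: "A * B = B * A'"
  shows "poly_mat A p * B = B * poly_mat A' p"
proof (induction p)
  case 0
  show ?case using A A' B by simp
next
  case (pCons a p)
  note c = poly_mat_carrier[OF A, of p] poly_mat_carrier[OF A', of p]
  have "poly_mat A (pCons a p) * B = a \<cdot>\<^sub>m B + A * (poly_mat A p * B)"
    using A B c by (simp add: poly_mat_pCons[OF A] add_mult_distrib_mat[of _ n n _ _ n]
        mult_smult_assoc_mat[of _ n n _ n] assoc_mult_mat[of _ n n _ n _ n])
  also have "A * (poly_mat A p * B) = B * (A' * poly_mat A' p)"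
    unfolding pCons using assoc_mult_mat[OF A B c(2)] assoc_mult_mat[OF B A' c(2)] AB by simp
  also have "a \<cdot>\<^sub>m B + B * (A' * poly_mat A' p) = B * poly_mat A' (pCons a p)"
    using A' B c by (simp add: poly_mat_pCons[OF A'] mult_add_distrib_mat[of _ n n _ n]
        mult_smult_distrib[of _ n n _ n])
  finally show ?case .
qed

lemma poly_mat_transpose:
  assumes A: "A \<in> carrier_mat n n"
  shows "(poly_mat A p)\<^sup>T = poly_mat A\<^sup>T p"
proof (induction p)
  case 0
  show ?case using A by (auto intro!: eq_matI)
next
  case (pCons a p)
  have AT: "A\<^sup>T \<in> carrier_mat n n" using A by simp
  note c = poly_mat_carrier[OF A, of p]
  have "A * poly_mat A p = poly_mat A p * A"
    by (rule poly_mat_intertwine[OF A A A refl, symmetric])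
  then have "(A * poly_mat A p)\<^sup>T = A\<^sup>T * poly_mat A\<^sup>T p"
    using transpose_mult[OF c A] pCons by simp
  moreover have "(a \<cdot>\<^sub>m 1\<^sub>m n)\<^sup>T = a \<cdot>\<^sub>m (1\<^sub>m n :: 'a mat)" by (auto intro!: eq_matI)
  ultimately show ?case
    using A c by (simp add: poly_mat_pCons[OF A] poly_mat_pCons[OF AT] transpose_add[of _ n n])
qed

lemma poly_mat_sum_index:
  assumes A: "A \<in> carrier_mat n n" and "i < n" "j < n"
  shows "poly_mat A (\<Sum>k\<in>S. f k) $$ (i, j) = (\<Sum>k\<in>S. poly_mat A (f k) $$ (i, j))"
  by (induction S rule: infinite_finite_induct) (use assms in \<open>simp_all add: poly_mat_add[OF A]\<close>)

lemma poly_mat_mult_index: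
  assumes A: "A \<in> carrier_mat n n" and "i < n" "j < n"
  shows "poly_mat A (p * q) $$ (i, j) =
    (\<Sum>m<n. poly_mat A p $$ (i, m) * poly_mat A q $$ (m, j))"
  using assms by (simp add: poly_mat_mult[OF A] scalar_prod_def atLeast0LessThan)

text \<open>The vectors of length \<open>n\<close> form a module over the polynomials in \<open>X\<close>, with \<open>X\<close> acting as \<open>A\<close>. Each
  column of \<open>T = X * 1 - A\<close> is a relation between the standard basis vectors in this module. The columns
  still are relations after multiplication of \<open>T\<close> with its adjugate, which turns \<open>T\<close> into the characteristic
  polynomial times the unit matrix. In coordinates this is an interchange of finite sums.\<close>

lemma Cayley_Hamilton:
  fixes A :: "'a :: comm_ring_1 mat"
  assumes A: "A \<in> carrier_mat n n"
  shows "poly_mat A (char_poly A) = 0\<^sub>m n n"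
proof (rule eq_matI)
  fix i j assume "i < dim_row (0\<^sub>m n n :: 'a mat)" "j < dim_col (0\<^sub>m n n :: 'a mat)"
  then have i: "i < n" and j: "j < n" by auto
  define T where "T = char_poly_matrix A"
  define Q where "Q = adj_mat T"
  have T: "T \<in> carrier_mat n n" unfolding T_def using A by simp
  have Q: "Q \<in> carrier_mat n n" unfolding Q_def by (rule adj_mat(1)[OF T])
  have TQ: "T * Q = char_poly A \<cdot>\<^sub>m 1\<^sub>m n"
    unfolding Q_def char_poly_def T_def[symmetric] by (rule adj_mat(2)[OF T])
  have T_index: "T $$ (l, k) = [:- A $$ (l, k), if l = k then 1 else 0:]" if "l < n" "k < n" for l k
    using that A unfolding T_def char_poly_matrix_def by auto
  \<comment> \<open>The annihilation just described: \<open>A * e\<^sub>k\<close> is the combination of the basis vectors given by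
     column \<open>k\<close> of \<open>A\<close>.\<close>
  have kill: "(\<Sum>l<n. poly_mat A (T $$ (l, k)) $$ (m, l)) = 0" if "m < n" "k < n" for m k
  proof -
    have "(\<Sum>l<n. poly_mat A (T $$ (l, k)) $$ (m, l)) =
        (\<Sum>l<n. (if l = k then A $$ (m, l) else 0) - (if l = m then A $$ (l, k) else 0))"
      using that A by (intro sum.cong) (auto simp: T_index poly_mat_linear[OF A])
    also have "\<dots> = 0" using that by (simp add: sum_subtractf)
    finally show ?thesis .
  qed
  have "poly_mat A (char_poly A) $$ (i, j) =
      (\<Sum>l<n. if l = j then poly_mat A (char_poly A) $$ (i, l) else 0)"
    using j by simp
  also have "\<dots> = (\<Sum>l<n. poly_mat A ((T * Q) $$ (l, j)) $$ (i, l))"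
    unfolding TQ using i j A by (intro sum.cong) auto
  also have "\<dots> = (\<Sum>l<n. \<Sum>k<n. poly_mat A (Q $$ (k, j) * T $$ (l, k)) $$ (i, l))"
    using i j T Q by (intro sum.cong)
      (auto simp: scalar_prod_def atLeast0LessThan poly_mat_sum_index[OF A] mult.commute)
  also have "\<dots> = (\<Sum>l<n. \<Sum>k<n. \<Sum>m<n.
      poly_mat A (Q $$ (k, j)) $$ (i, m) * poly_mat A (T $$ (l, k)) $$ (m, l))"
    using i by (intro sum.cong) (auto simp: poly_mat_mult_index[OF A])
  also have "\<dots> = (\<Sum>k<n. \<Sum>m<n.
      poly_mat A (Q $$ (k, j)) $$ (i, m) * (\<Sum>l<n. poly_mat A (T $$ (l, k)) $$ (m, l)))"
    unfolding sum_distrib_left by (subst sum.swap) (intro sum.cong sum.swap refl)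
  also have "\<dots> = 0" by (intro sum.neutral) (auto simp: kill)
  finally show "poly_mat A (char_poly A) $$ (i, j) = 0\<^sub>m n n $$ (i, j)"
    using i j by simp
qed (use A in auto)

lemma poly_mat_1: "A \<in> carrier_mat n n \<Longrightarrow> poly_mat A 1 = 1\<^sub>m n"
  by (simp add: one_pCons poly_mat_const) auto

lemma poly_mat_X: "A \<in> carrier_mat n n \<Longrightarrow> poly_mat A [:0, 1:] = A"
  by (auto simp: poly_mat_linear intro!: eq_matI)

lemma poly_mat_char_matrix: "A \<in> carrier_mat n n \<Longrightarrow> poly_mat A [:- k, 1:] = char_matrix A k"
  by (auto simp: poly_mat_linear char_matrix_def intro!: eq_matI)

lemma poly_mat_cong:
  assumes A: "A \<in> carrier_mat n n" and "char_poly A dvd p - q"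
  shows "poly_mat A p = poly_mat A q"
proof -
  obtain h where "p = q + char_poly A * h"
    using assms(2) by (metis dvdE diff_add_cancel add.commute)
  then show ?thesis
    using poly_mat_carrier[OF A]
    by (simp add: poly_mat_add[OF A] poly_mat_mult[OF A] Cayley_Hamilton[OF A]
        left_mult_zero_mat[of _ n n] right_add_zero_mat[of _ n n])
qed

section \<open>The quadratic extension generated by a Wonenburger matrix\<close>

text \<open>The matrix representing \<open>p + q * t\<close> in the commutative ring generated over the real polynomials in
  \<open>x\<close> by a square root \<open>t\<close> of \<open>x\<^sup>2 - 1\<close>, where \<open>x\<close> acts as the block diagonal matrix of \<open>A\<close> and \<open>A\<^sup>T\<close>, and \<open>t\<close> as
  the block antidiagonal matrix of \<open>B\<close> and \<open>C\<close>. The relation \<open>t\<^sup>2 = x\<^sup>2 - 1\<close> comes from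
  \<open>B * C = A\<^sup>2 - 1\<close>, and \<open>M\<close> itself is \<open>x + t\<close>.\<close>

definition wmat :: "real mat \<Rightarrow> real mat \<Rightarrow> real mat \<Rightarrow> real poly \<Rightarrow> real poly \<Rightarrow> real mat" where
  "wmat A B C p q = four_block_mat (poly_mat A p) (B * poly_mat A\<^sup>T q) (C * poly_mat A q) (poly_mat A\<^sup>T p)"

context
  fixes n :: nat and M A B C :: "real mat"
  assumes W: "wonenburger n M A B C"
begin

lemma wonenburger_carriers:
  "A \<in> carrier_mat n n" "B \<in> carrier_mat n n" "C \<in> carrier_mat n n" "A\<^sup>T \<in> carrier_mat n n"
  using W by (auto simp: wonenburger_def)

lemma wonenburger_symmetric: "B\<^sup>T = B" "C\<^sup>T = C"
  using W by (auto simp: wonenburger_def)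

lemmas poly_A_carrier = poly_mat_carrier[OF wonenburger_carriers(1)]
lemmas poly_AT_carrier = poly_mat_carrier[OF wonenburger_carriers(4)]

lemma wonenburger_intertwine:
  "poly_mat A p * B = B * poly_mat A\<^sup>T p" "poly_mat A\<^sup>T p * C = C * poly_mat A p"
  by (rule poly_mat_intertwine; use W in \<open>auto simp: wonenburger_def\<close>)+

lemma wonenburger_BC: "B * C = poly_mat A [:-1, 0, 1:]"
proof -
  have Q: "Q = (-1) \<cdot>\<^sub>m 1\<^sub>m n + P"
    if "P \<in> carrier_mat n n" "Q \<in> carrier_mat n n" "P - Q = 1\<^sub>m n" for P Q :: "real mat"
    unfolding that(3)[symmetric] using that(1,2) by (intro eq_matI) auto
  have "B * C = (-1) \<cdot>\<^sub>m 1\<^sub>m n + A * A"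
    by (rule Q) (use W in \<open>auto simp: wonenburger_def\<close>)
  also have "\<dots> = poly_mat A [:-1, 0, 1:]"
    by (simp add: poly_mat_pCons[OF wonenburger_carriers(1), of "-1"] poly_mat_X[OF wonenburger_carriers(1)])
  finally show ?thesis .
qed

lemma wonenburger_CB: "C * B = poly_mat A\<^sup>T [:-1, 0, 1:]"
proof -
  have "C * B = (B * C)\<^sup>T"
    using wonenburger_carriers wonenburger_symmetric by (simp add: transpose_mult[of B n n C n])
  then show ?thesis by (simp add: wonenburger_BC poly_mat_transpose[OF wonenburger_carriers(1)])
qed

lemma BC_block: "B * poly_mat A\<^sup>T f * (C * poly_mat A g) = poly_mat A ([:-1, 0, 1:] * (f * g))"
proof -
  note c = wonenburger_carriers poly_A_carrier poly_AT_carrier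
  have "B * poly_mat A\<^sup>T f * (C * poly_mat A g) = B * ((poly_mat A\<^sup>T f * C) * poly_mat A g)"
    using c by (simp add: assoc_mult_mat[of _ n n _ n _ n])
  also have "\<dots> = B * (C * (poly_mat A f * poly_mat A g))"
    unfolding wonenburger_intertwine using c by (simp add: assoc_mult_mat[of _ n n _ n _ n])
  also have "\<dots> = (B * C) * (poly_mat A f * poly_mat A g)"
    by (rule assoc_mult_mat[symmetric]) (use c in auto)
  finally show ?thesis unfolding wonenburger_BC poly_mat_mult[OF wonenburger_carriers(1)] .
qed

lemma CB_block: "C * poly_mat A f * (B * poly_mat A\<^sup>T g) = poly_mat A\<^sup>T ([:-1, 0, 1:] * (f * g))"
proof -
  note c = wonenburger_carriers poly_A_carrier poly_AT_carrier
  have "C * poly_mat A f * (B * poly_mat A\<^sup>T g) = C * ((poly_mat A f * B) * poly_mat A\<^sup>T g)"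
    using c by (simp add: assoc_mult_mat[of _ n n _ n _ n])
  also have "\<dots> = C * (B * (poly_mat A\<^sup>T f * poly_mat A\<^sup>T g))"
    unfolding wonenburger_intertwine using c by (simp add: assoc_mult_mat[of _ n n _ n _ n])
  also have "\<dots> = (C * B) * (poly_mat A\<^sup>T f * poly_mat A\<^sup>T g)"
    by (rule assoc_mult_mat[symmetric]) (use c in auto)
  finally show ?thesis unfolding wonenburger_CB poly_mat_mult[OF wonenburger_carriers(4)] .
qed

lemma B_block:
  "poly_mat A f * (B * poly_mat A\<^sup>T g) = B * poly_mat A\<^sup>T (f * g)"
  "B * poly_mat A\<^sup>T g * poly_mat A\<^sup>T f = B * poly_mat A\<^sup>T (g * f)"
  by (simp_all only: assoc_mult_mat[OF poly_A_carrier wonenburger_carriers(2) poly_AT_carrier, symmetric] wonenburger_intertwine(1)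
      assoc_mult_mat[OF wonenburger_carriers(2) poly_AT_carrier poly_AT_carrier] poly_mat_mult[OF wonenburger_carriers(4)])

lemma C_block:
  "poly_mat A\<^sup>T f * (C * poly_mat A g) = C * poly_mat A (f * g)"
  "C * poly_mat A g * poly_mat A f = C * poly_mat A (g * f)"
  by (simp_all only: assoc_mult_mat[OF poly_AT_carrier wonenburger_carriers(3) poly_A_carrier, symmetric] wonenburger_intertwine(2)
      assoc_mult_mat[OF wonenburger_carriers(3) poly_A_carrier poly_A_carrier] poly_mat_mult[OF wonenburger_carriers(1)])

lemma wmat_carrier [simp]: "wmat A B C p q \<in> carrier_mat (n + n) (n + n)"
  unfolding wmat_def using poly_A_carrier poly_AT_carrier by simp

text \<open>Moving a polynomial in \<open>A\<close> past \<open>B\<close> turns it into the same polynomial in \<open>A\<^sup>T\<close>, and conversely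
  for \<open>C\<close>; this keeps the block form, and the two factors \<open>t\<close> meet as \<open>B * C\<close> or \<open>C * B\<close>.\<close>

lemma wmat_mult:
  "wmat A B C p q * wmat A B C p' q' =
     wmat A B C (p * p' + [:-1, 0, 1:] * (q * q')) (p * q' + q * p')"
proof -
  note mA = poly_mat_mult[OF wonenburger_carriers(1)] and mT = poly_mat_mult[OF wonenburger_carriers(4)]
  note c = wonenburger_carriers poly_A_carrier poly_AT_carrier
  have sums: "B * poly_mat A\<^sup>T f + B * poly_mat A\<^sup>T g = B * poly_mat A\<^sup>T (f + g)"
    "C * poly_mat A f + C * poly_mat A g = C * poly_mat A (f + g)" for f g
    using c by (simp_all add: poly_mat_add[OF wonenburger_carriers(1)] poly_mat_add[OF wonenburger_carriers(4)]
        mult_add_distrib_mat[of _ n n _ n])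
  have "wmat A B C p q * wmat A B C p' q' = four_block_mat
      (poly_mat A p * poly_mat A p' + B * poly_mat A\<^sup>T q * (C * poly_mat A q'))
      (poly_mat A p * (B * poly_mat A\<^sup>T q') + B * poly_mat A\<^sup>T q * poly_mat A\<^sup>T p')
      (C * poly_mat A q * poly_mat A p' + poly_mat A\<^sup>T p * (C * poly_mat A q'))
      (C * poly_mat A q * (B * poly_mat A\<^sup>T q') + poly_mat A\<^sup>T p * poly_mat A\<^sup>T p')"
    unfolding wmat_def by (rule mult_four_block_mat) (use c in auto)
  also have "\<dots> = four_block_mat
      (poly_mat A (p * p' + [:-1, 0, 1:] * (q * q'))) (B * poly_mat A\<^sup>T (p * q' + q * p'))
      (C * poly_mat A (q * p' + p * q')) (poly_mat A\<^sup>T ([:-1, 0, 1:] * (q * q') + p * p'))"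
    by (simp only: BC_block CB_block B_block C_block sums mA[symmetric] mT[symmetric]
        poly_mat_add[OF wonenburger_carriers(1), symmetric] poly_mat_add[OF wonenburger_carriers(4), symmetric])
  finally show ?thesis
    unfolding wmat_def by (simp only: add.commute)
qed

lemma wmat_M: "M = wmat A B C [:0, 1:] 1"
  using W wonenburger_carriers by (simp add: wmat_def poly_mat_X poly_mat_1 wonenburger_def)

lemma wmat_1: "wmat A B C 1 0 = 1\<^sub>m (n + n)"
  using wonenburger_carriers by (simp add: wmat_def poly_mat_1)

lemma wmat_char_matrix: "wmat A B C [:- k, 1:] 1 = char_matrix M k"
  using W wonenburger_carriers
  by (auto simp: wmat_def poly_mat_linear poly_mat_1 wonenburger_def char_matrix_def intro!: eq_matI)

text \<open>By Cayley and Hamilton, the coefficients \<open>p, q\<close> matter only modulo the characteristic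
  polynomial of \<open>A\<close>.\<close>

lemma wmat_cong:
  assumes "char_poly A dvd p - p'" "char_poly A dvd q - q'"
  shows "wmat A B C p q = wmat A B C p' q'"
  using poly_mat_cong[OF wonenburger_carriers(1) assms(1)] poly_mat_cong[OF wonenburger_carriers(1) assms(2)]
  by (simp add: wmat_def poly_mat_transpose[OF wonenburger_carriers(1), symmetric])

lemma det_wmat_0: "det (wmat A B C p 0) = det (poly_mat A p) ^ 2"
proof -
  have "wmat A B C p 0 = four_block_mat (poly_mat A p) (0\<^sub>m n n) (0\<^sub>m n n) (poly_mat A\<^sup>T p)"
    using wonenburger_carriers by (simp add: wmat_def)
  then have "det (wmat A B C p 0) = det (poly_mat A p) * det (poly_mat A\<^sup>T p)"
    using det_four_block_mat_lower_left_zero[OF poly_A_carrier _ refl poly_AT_carrier] by simp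
  then show ?thesis
    using det_transpose[OF poly_A_carrier[of p]]
    by (simp add: poly_mat_transpose[OF wonenburger_carriers(1)] power2_eq_square)
qed

text \<open>The assumption says that \<open>p + q * t\<close> has norm one modulo the characteristic polynomial of \<open>A\<close>, the
  norm being the product with the conjugate \<open>p - q * t\<close>. So every element of norm one is again a Wonenburger matrix, hence symplectic.\<close>

lemma wonenburger_wmat:
  assumes "char_poly A dvd p\<^sup>2 - [:-1, 0, 1:] * q\<^sup>2 - 1"
  shows "wonenburger n (wmat A B C p q) (poly_mat A p) (B * poly_mat A\<^sup>T q) (C * poly_mat A q)"
proof -
  note c = wonenburger_carriers poly_A_carrier poly_AT_carrier
  have sB: "(B * poly_mat A\<^sup>T q)\<^sup>T = B * poly_mat A\<^sup>T q"
    using transpose_mult[OF wonenburger_carriers(2) poly_AT_carrier]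
    by (simp add: wonenburger_symmetric poly_mat_transpose[OF wonenburger_carriers(4)] wonenburger_intertwine)
  have sC: "(C * poly_mat A q)\<^sup>T = C * poly_mat A q"
    using transpose_mult[OF wonenburger_carriers(3) poly_A_carrier]
    by (simp add: wonenburger_symmetric poly_mat_transpose[OF wonenburger_carriers(1)] wonenburger_intertwine)
  have "poly_mat A p * (B * poly_mat A\<^sup>T q) = B * poly_mat A\<^sup>T q * poly_mat A\<^sup>T p"
    "poly_mat A\<^sup>T p * (C * poly_mat A q) = C * poly_mat A q * poly_mat A p"
    unfolding B_block C_block by (simp_all add: mult.commute)
  moreover have "poly_mat A p * poly_mat A p - B * poly_mat A\<^sup>T q * (C * poly_mat A q) = 1\<^sub>m n"
  proof -
    have "poly_mat A p * poly_mat A p = poly_mat A (1 + [:-1, 0, 1:] * q\<^sup>2)"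
      unfolding poly_mat_mult[OF wonenburger_carriers(1), symmetric]
      by (rule poly_mat_cong[OF wonenburger_carriers(1)]) (use assms in \<open>simp add: power2_eq_square algebra_simps\<close>)
    then show ?thesis unfolding BC_block power2_eq_square
      using wonenburger_carriers(1) by (auto simp: poly_mat_add[OF wonenburger_carriers(1)] poly_mat_1 simp del: mult_pCons_left
          intro!: eq_matI)
  qed
  ultimately show ?thesis using c sB sC
    unfolding wonenburger_def by (simp add: poly_mat_transpose wmat_def)
qed

section \<open>Eigenvalues\<close>

text \<open>From \<open>t\<^sup>2 = x\<^sup>2 - 1\<close> follows \<open>M\<^sup>2 + 1 = 2 * x * M\<close>. Hence the product \<open>(M - k) * (M - 1 / k)\<close> equals
  \<open>2 * (x - \<mu>) * M\<close>, and \<open>x\<close> is block diagonal with blocks \<open>A\<close> and \<open>A\<^sup>T\<close>.\<close>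

lemma det_char_matrix_wonenburger:
  assumes "k \<noteq> 0"
  defines "\<mu> \<equiv> (k + 1 / k) / 2"
  shows "det (char_matrix M k) * det (char_matrix M (1 / k)) =
    4 ^ n * det (char_matrix A \<mu>) ^ 2 * det M"
proof -
  have det_prod: "det (wmat A B C p q * wmat A B C p' q') = det (wmat A B C p q) * det (wmat A B C p' q')"
    for p q p' q' by (rule det_mult[OF wmat_carrier wmat_carrier])
  have "[:- k, 1:] * [:- (1 / k), 1:] + [:- 1, 0, 1:] * (1 * 1) = [:- 2 * \<mu>, 2:] * [:0, 1:] + [:-1, 0, 1:] * (0 * 1)"
    using assms(1) by (simp add: \<mu>_def)
  moreover have "[:- k, 1:] * 1 + 1 * [:- (1 / k), 1:] = [:- 2 * \<mu>, 2:] * 1 + 0 * [:0, 1:]"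
    by (simp add: \<mu>_def)
  ultimately have "wmat A B C [:- k, 1:] 1 * wmat A B C [:- (1 / k), 1:] 1 =
      wmat A B C [:- 2 * \<mu>, 2:] 0 * wmat A B C [:0, 1:] 1"
    unfolding wmat_mult by (simp only:)
  from arg_cong[OF this, of det, unfolded det_prod]
  have "det (char_matrix M k) * det (char_matrix M (1 / k)) = det (poly_mat A [:- 2 * \<mu>, 2:]) ^ 2 * det M"
    unfolding wmat_char_matrix wmat_M[symmetric] det_wmat_0 .
  moreover have "poly_mat A [:- 2 * \<mu>, 2:] = 2 \<cdot>\<^sub>m char_matrix A \<mu>"
    using poly_mat_smult[OF wonenburger_carriers(1), of 2 "[:- \<mu>, 1:]"]
    by (simp add: poly_mat_char_matrix[OF wonenburger_carriers(1)])
  moreover have "det (2 \<cdot>\<^sub>m char_matrix A \<mu>) = 2 ^ n * det (char_matrix A \<mu>)"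
    using char_matrix_closed[OF wonenburger_carriers(1), of \<mu>] by auto
  moreover have "((2::real) ^ n)\<^sup>2 = 4 ^ n" by (simp add: power2_eq_square flip: power_mult_distrib)
  ultimately show ?thesis by (simp only: power_mult_distrib)
qed

lemma det_wonenburger_nonzero: "det M \<noteq> 0"
proof
  assume "det M = 0"
  \<comment> \<open>The conjugate \<open>x - t\<close> inverts \<open>x + t\<close>.\<close>
  have "wmat A B C [:0, 1:] 1 * wmat A B C [:0, 1:] (- 1) = 1\<^sub>m (n + n)"
    unfolding wmat_mult wmat_1[symmetric] by (rule arg_cong2[of _ _ _ _ "wmat A B C"]) (simp_all add: one_pCons)
  then have "M * wmat A B C [:0, 1:] (- 1) = 1\<^sub>m (n + n)"
    unfolding wmat_M[symmetric] .
  moreover have "M \<in> carrier_mat (n + n) (n + n)" by (subst wmat_M) (rule wmat_carrier)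
  ultimately have "det M * det (wmat A B C [:0, 1:] (- 1)) = 1"
    using det_mult[OF _ wmat_carrier, of M "[:0, 1:]" "- 1"] by simp
  with \<open>det M = 0\<close> show False by simp
qed

lemma eigenvalue_wonenburger_iff:
  assumes "k \<noteq> 0"
  shows "eigenvalue M k \<or> eigenvalue M (1 / k) \<longleftrightarrow> eigenvalue A ((k + 1 / k) / 2)"
proof -
  have "M \<in> carrier_mat (n + n) (n + n)" by (subst wmat_M) (rule wmat_carrier)
  then show ?thesis
    using det_char_matrix_wonenburger[OF assms] det_wonenburger_nonzero wonenburger_carriers(1)
    by (auto simp: eigenvalue_det)
qed

end

lemma of_real_in_cspectrum_iff:
  assumes "M \<in> carrier_mat n n"
  shows "complex_of_real r \<in> cspectrum M \<longleftrightarrow> eigenvalue M r"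
  using assms unfolding cspectrum_def
  by (simp add: spectrum_root_char_poly[of _ n] eigenvalue_root_char_poly of_real_hom.char_poly_hom)

text \<open>The Joukowski map \<open>k \<mapsto> (k + 1 / k) / 2\<close> sends the negative axis onto the half-line of all numbers up to
  \<open>-1\<close>; the preimage chosen here is the root of \<open>k\<^sup>2 - 2 * m * k + 1\<close> that is negative by inspection.\<close>

lemma joukowski_neg:
  fixes m :: real
  shows "m \<le> -1 \<longleftrightarrow> (\<exists>k<0. (k + 1 / k) / 2 = m)"
proof
  assume m: "m \<le> -1"
  define k where "k = m - sqrt (m\<^sup>2 - 1)"
  have "1\<^sup>2 \<le> (- m)\<^sup>2" using m by (intro power_mono) auto
  then have sq: "0 \<le> m\<^sup>2 - 1" by simp
  then have "0 \<le> sqrt (m\<^sup>2 - 1)" by (rule real_sqrt_ge_zero)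
  then have k: "k < 0" unfolding k_def using m by linarith
  have "(m - k)\<^sup>2 = m\<^sup>2 - 1" unfolding k_def using sq by simp
  then have "k * k + 1 = 2 * m * k" by (simp add: power2_eq_square algebra_simps)
  then have "k + 1 / k = 2 * m" using k by (simp add: divide_simps)
  then show "\<exists>k<0. (k + 1 / k) / 2 = m" using k by (intro exI[of _ k]) simp
next
  assume "\<exists>k<0. (k + 1 / k) / 2 = m"
  then obtain k where k: "k < 0" "(k + 1 / k) / 2 = m" by blast
  define s where "s = k + 1 / k"
  have "(k + 1)\<^sup>2 / k \<le> 0" using k(1) by (intro divide_nonneg_nonpos) auto
  moreover have "(k + 1)\<^sup>2 / k = s + 2"
    using k(1) by (simp add: s_def power2_eq_square add_divide_distrib distrib_left distrib_right)
  ultimately have "s + 2 \<le> 0" by (simp only:)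
  moreover have "s / 2 = m" using k(2) by (simp only: s_def)
  ultimately show "m \<le> -1" by simp
qed

lemma neg_spectrum_wonenburger_iff:
  assumes W: "wonenburger n M A B C"
  shows "cspectrum M \<inter> complex_of_real ` {..<0} = {} \<longleftrightarrow>
    cspectrum A \<inter> complex_of_real ` {..-1} = {}"
proof -
  have "M \<in> carrier_mat (n + n) (n + n)" by (subst wmat_M[OF W]) (rule wmat_carrier[OF W])
  note specM = of_real_in_cspectrum_iff[OF this] and specA = of_real_in_cspectrum_iff[OF wonenburger_carriers(1)[OF W]]
  have "(\<exists>k<0. eigenvalue M k) \<longleftrightarrow> (\<exists>m\<le>-1. eigenvalue A m)"
  proof
    assume "\<exists>k<0. eigenvalue M k"
    then obtain k where k: "k < 0" "eigenvalue M k" by blast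
    then have "eigenvalue A ((k + 1 / k) / 2)" using eigenvalue_wonenburger_iff[OF W, of k] by blast
    moreover have "(k + 1 / k) / 2 \<le> -1" unfolding joukowski_neg using k(1) by blast
    ultimately show "\<exists>m\<le>-1. eigenvalue A m" by blast
  next
    assume "\<exists>m\<le>-1. eigenvalue A m"
    then obtain k where k: "k < 0" "eigenvalue A ((k + 1 / k) / 2)" by (auto simp: joukowski_neg)
    then have "eigenvalue M k \<or> eigenvalue M (1 / k)"
      using eigenvalue_wonenburger_iff[OF W, of k] by blast
    moreover have "1 / k < 0" using k(1) by simp
    ultimately show "\<exists>k<0. eigenvalue M k" using k(1) by blast
  qed
  moreover have "cspectrum M \<inter> complex_of_real ` {..<0} = {} \<longleftrightarrow> \<not> (\<exists>k<0. eigenvalue M k)"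
    using specM by blast
  moreover have "cspectrum A \<inter> complex_of_real ` {..-1} = {} \<longleftrightarrow> \<not> (\<exists>m\<le>-1. eigenvalue A m)"
    using specA by blast
  ultimately show ?thesis by blast
qed

section \<open>The square root\<close>

text \<open>For a matrix in \<open>SL\<^sub>2\<close> of trace above \<open>-2\<close> a square root is \<open>(M + 1) / sqrt (tr M + 2)\<close>. The role of the
  trace is played by \<open>2 * x\<close>, so the root sought is \<open>(M + 1) * r\<close> with \<open>r\<close> an inverse square root of
  \<open>2 + 2 * x\<close>, taken to be a polynomial in \<open>x\<close>.\<close>

lemma wonenburger_sqrt:
  assumes W: "wonenburger n M A B C"
    and spec: "cspectrum A \<inter> complex_of_real ` {..-1} = {}"
  shows "\<exists>X. symplectic_sqrt n M X"
proof -
  note A = wonenburger_carriers(1)[OF W]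
  have "char_poly A \<noteq> 0" using degree_monic_char_poly[OF A] by auto
  moreover have "ceval [:2, 2:] z \<notin> complex_of_real ` {..0}" if z: "ceval (char_poly A) z = 0" for z
  proof
    assume "ceval [:2, 2:] z \<in> complex_of_real ` {..0}"
    then obtain s where s: "s \<le> 0" "2 + 2 * z = complex_of_real s"
      by (auto simp: hom_distribs mult.commute)
    then have "z = complex_of_real (s / 2 - 1)" by (simp add: field_simps)
    then have "z \<in> complex_of_real ` {..-1}"
      by (rule image_eqI) (use s(1) in simp)
    moreover have "z \<in> cspectrum A"
      unfolding cspectrum_def using z A
      by (simp add: spectrum_root_char_poly[of _ n] of_real_hom.char_poly_hom)
    ultimately show False using spec by blast
  qed
  ultimately obtain r where r: "char_poly A dvd r\<^sup>2 * [:2, 2:] - 1"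
    using inverse_sqrt_mod by blast
  define u v w x :: "real poly"
    where "u = [:1, 1:]" and "v = [:2, 2:]" and "w = [:-1, 0, 1:]" and "x = [:0, 1:]"
  have uw: "u * u - w = v" "u * u + w = v * x" "u + u = v"
    unfolding u_def v_def w_def x_def by simp_all
  define X where "X = wmat A B C (u * r) r"
  have "(u * r)\<^sup>2 - w * r\<^sup>2 - 1 = r\<^sup>2 * v - 1"
    unfolding uw(1)[symmetric] by (simp add: power2_eq_square algebra_simps)
  then have "char_poly A dvd (u * r)\<^sup>2 - w * r\<^sup>2 - 1" using r by (simp only: v_def)
  then have "wonenburger n X (poly_mat A (u * r)) (B * poly_mat A\<^sup>T r) (C * poly_mat A r)"
    unfolding X_def w_def by (rule wonenburger_wmat[OF W])
  then have "X \<in> Sp n" by (rule wonenburger_in_Sp)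
  moreover have "X ^\<^sub>m 2 = M"
  proof -
    have "X ^\<^sub>m 2 = X * X"
      using wmat_carrier[OF W, of "u * r" r] by (simp add: X_def numeral_2_eq_2)
    also have "\<dots> = wmat A B C (u * r * (u * r) + w * (r * r)) (u * r * r + r * (u * r))"
      unfolding X_def w_def by (rule wmat_mult[OF W])
    also have "u * r * (u * r) + w * (r * r) = (u * u + w) * r\<^sup>2"
      by (simp add: power2_eq_square algebra_simps)
    also have "u * r * r + r * (u * r) = (u + u) * r\<^sup>2"
      by (simp add: power2_eq_square algebra_simps)
    also have "wmat A B C ((u * u + w) * r\<^sup>2) ((u + u) * r\<^sup>2) = wmat A B C x 1"
      unfolding uw
    proof (rule wmat_cong[OF W])
      have 1: "char_poly A dvd r\<^sup>2 * v - 1" unfolding v_def by (rule r)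
      have "v * x * r\<^sup>2 - x = (r\<^sup>2 * v - 1) * x" by (simp add: algebra_simps)
      then show "char_poly A dvd v * x * r\<^sup>2 - x" using 1 by (simp only: dvd_mult2)
      show "char_poly A dvd v * r\<^sup>2 - 1" using 1 by (simp only: mult.commute)
    qed
    also have "wmat A B C x 1 = M" unfolding x_def by (rule wmat_M[OF W, symmetric])
    finally show ?thesis .
  qed
  ultimately show ?thesis unfolding symplectic_sqrt_def by blast
qed

theorem theoremA:
  fixes n :: nat and M A B C :: "real mat"
  assumes "wonenburger n M A B C"
  shows "(cspectrum M \<inter> complex_of_real ` {..<0} = {} \<longleftrightarrow>
            cspectrum A \<inter> complex_of_real ` {..-1} = {}) \<and>
         (cspectrum M \<inter> complex_of_real ` {..<0} = {} \<longrightarrow>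
            (\<exists>X. symplectic_sqrt n M X))"
  using neg_spectrum_wonenburger_iff[OF assms] wonenburger_sqrt[OF assms] by blast

end
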